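(* Let $q,\upsilon,\gamma_1,\gamma_2,\gamma_3,\theta\in\mathbb{C}$ with $\operatorname{Re}(q)>0$, $\operatorname{Re}(\upsilon)>0$ and $\gamma_3,\theta\notin\{0,-1,-2,\dots\}$. Then, for $0<z<\tfrac14$ and $t>0$, $$E_{\gamma_{3},\theta;q;\upsilon}^{(\gamma_{1};\gamma_{2})}(z,t)=\frac{z^{1-\theta}t^{1-q}}{(1-D_{t}^{-\upsilon})^{\gamma_{2}}}\;{}_{3}F_{1}\left[\begin{matrix}\frac{\gamma_{1}}{2},\frac{\gamma_{1}+1}{2},\gamma_{2}\\ \gamma_{3}\end{matrix};\frac{-4}{D_{z}(1-D_{t}^{-\upsilon})}\right]\left\{\frac{z^{\theta-1}t^{q-1}}{\Gamma(q)}\right\}.$$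
   Context: $(a)_n$ is the Pochhammer symbol. The bivariate I-Konhauser Mittag-Leffler function is $$E_{\gamma_{3},\gamma_{4};q;\upsilon}^{(\gamma_{1};\gamma_{2})}(z,t)=\sum_{l=0}^{\infty}\sum_{n=0}^{\infty}\frac{(-1)^{n}(\gamma_{1})_{2n}(\gamma_{2})_{l+n}\,z^{n}t^{\upsilon l}}{(\gamma_{3})_{n}(\gamma_{4})_{n}\,\Gamma(q+\upsilon l)\,n!\,l!},$$ for $\operatorname{Re}(q)>0$, $\operatorname{Re}(\upsilon)>0$, $\gamma_3,\gamma_4\notin\{0,-1,-2,\dots\}$, considered for $-\frac14<z<\frac14$. Operator conventions: $D_t^{-1}f(t)=\int_0^t f(\xi)\,d\xi$ (similarly $D_z^{-1}$), and the action of inverse powers on power functions is $D_z^{-n}z^{\theta-1}=\dfrac{z^{\theta+n-1}}{(\theta)_n}$ and $D_t^{-\upsilon l}t^{q-1}=\dfrac{\Gamma(q)\,t^{q+\upsilon l-1}}{\Gamma(q+\upsilon l)}$. The right-hand side is the formal series of commuting operators $D_z^{-1},D_t^{-\upsilon}$ applied termwise: ${}_3F_1[a,b,c;d;X]=\sum_{n\ge0}\frac{(a)_n(b)_n(c)_n}{(d)_n\,n!}X^n$ with $X^n=(-4)^nD_z^{-n}(1-D_t^{-\upsilon})^{-n}$, and $(1-D_t^{-\upsilon})^{-\gamma}=\sum_{l\ge0}\frac{(\gamma)_l}{l!}D_t^{-\upsilon l}$. *)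

theory Defs
  imports "HOL-Analysis.Analysis" "HOL-Computational_Algebra.Formal_Power_Series"
begin

section \<open>The bivariate I-Konhauser Mittag-Leffler function\<close>

definition ikml_term ::
  "complex \<Rightarrow> complex \<Rightarrow> complex \<Rightarrow> complex \<Rightarrow> complex \<Rightarrow> complex \<Rightarrow> real \<Rightarrow> real \<Rightarrow> nat \<Rightarrow> nat \<Rightarrow> complex"
  where
  "ikml_term \<gamma>1 \<gamma>2 \<gamma>3 \<gamma>4 q \<upsilon> z t l n =
     (-1) ^ n * pochhammer \<gamma>1 (2 * n) * pochhammer \<gamma>2 (l + n)
       * of_real z ^ n * of_real t powr (\<upsilon> * of_nat l)
     / (pochhammer \<gamma>3 n * pochhammer \<gamma>4 n * Gamma (q + \<upsilon> * of_nat l) * fact n * fact l)"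

definition ikml ::
  "complex \<Rightarrow> complex \<Rightarrow> complex \<Rightarrow> complex \<Rightarrow> complex \<Rightarrow> complex \<Rightarrow> real \<Rightarrow> real \<Rightarrow> complex"
  where
  "ikml \<gamma>1 \<gamma>2 \<gamma>3 \<gamma>4 q \<upsilon> z t = (\<Sum>l. \<Sum>n. ikml_term \<gamma>1 \<gamma>2 \<gamma>3 \<gamma>4 q \<upsilon> z t l n)"


section \<open>Inverse powers of derivatives acting on power functions\<close>

text \<open>
  The term \<open>Power c a b\<close> stands for the function \<open>c z\<^sup>a\<^sup>-\<^sup>1 t\<^sup>b\<^sup>-\<^sup>1\<close> of \<open>z, t > 0\<close>.
  The action of the operators is prescribed on such functions, and this makes
  sense for exponents \<open>a\<close> with \<open>Re a \<le> 0\<close> too, where the integral from 0 diverges.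
\<close>

datatype power_term = Power complex complex complex

fun power_eval :: "power_term \<Rightarrow> real \<Rightarrow> real \<Rightarrow> complex" where
  "power_eval (Power c a b) z t = c * of_real z powr (a - 1) * of_real t powr (b - 1)"

fun Dz_neg :: "nat \<Rightarrow> power_term \<Rightarrow> power_term" where
  "Dz_neg n (Power c a b) = Power (c / pochhammer a n) (a + of_nat n) b"

text \<open>\<open>Dt_neg \<upsilon> l\<close> is the operator \<open>D\<^sub>t\<close> to the power \<open>- \<upsilon> l\<close>.\<close>

fun Dt_neg :: "complex \<Rightarrow> nat \<Rightarrow> power_term \<Rightarrow> power_term" where
  "Dt_neg \<upsilon> l (Power c a b) =
     Power (c * Gamma b / Gamma (b + \<upsilon> * of_nat l)) a (b + \<upsilon> * of_nat l)"

text \<open>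
  Consistency of the prescribed action: the powers compose and commute, the first
  ones are integration from 0 where that integral converges, and differentiation
  undoes \<open>Dz_neg 1\<close> for all admissible exponents.
\<close>

lemma Dz_neg_add: "Dz_neg m (Dz_neg n p) = Dz_neg (n + m) p"
  by (cases p) (simp add: pochhammer_product' add.assoc)

lemma Dt_neg_add:
  assumes "Re b > 0" "Re \<upsilon> > 0"
  shows "Dt_neg \<upsilon> m (Dt_neg \<upsilon> l (Power c a b)) = Dt_neg \<upsilon> (l + m) (Power c a b)"
proof -
  have "Re (b + \<upsilon> * of_nat l) > 0"
    using assms by (simp add: add_pos_nonneg)
  hence "b + \<upsilon> * of_nat l \<notin> \<int>\<^sub>\<le>\<^sub>0"
    by (auto elim!: nonpos_Ints_cases simp del: plus_complex.sel times_complex.sel)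
  hence "Gamma (b + \<upsilon> * of_nat l) \<noteq> 0"
    by (simp add: Gamma_eq_zero_iff)
  thus ?thesis by (simp add: algebra_simps)
qed

lemma Dz_neg_Dt_neg_commute: "Dz_neg n (Dt_neg \<upsilon> l p) = Dt_neg \<upsilon> l (Dz_neg n p)"
  by (cases p) simp

lemma has_vector_derivative_powr:
  fixes a :: complex and x :: real
  assumes "x > 0" "a \<noteq> 0"
  shows "((\<lambda>x. of_real x powr a / a) has_vector_derivative (of_real x powr (a - 1)))
           (at x within S)"
proof -
  have "((\<lambda>w::complex. w powr a / a) has_field_derivative (a * of_real x powr (a - 1)) / a)
          (at (of_real x))"
    using assms by (intro DERIV_cdivide has_field_derivative_powr) (auto simp: complex_nonpos_Reals_iff)
  hence "((\<lambda>w::complex. w powr a / a) has_field_derivative of_real x powr (a - 1)) (at (of_real x))"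
    using assms by simp
  from has_vector_derivative_real_field[OF this] show ?thesis
    by (simp add: o_def)
qed

lemma has_integral_powr_from_0:
  fixes a :: complex and x :: real
  assumes "Re a > 0" "x > 0"
  shows "((\<lambda>\<xi>. of_real \<xi> powr (a - 1)) has_integral of_real x powr a / a) {0..x}"
proof -
  have a: "a \<noteq> 0" using assms by auto
  have cont: "continuous_on {0..x} (\<lambda>\<xi>::real. of_real \<xi> powr a / a)"
    using assms a
    by (intro continuous_intros continuous_on_powr_complex) (auto simp: complex_nonneg_Reals_iff)
  have "((\<lambda>\<xi>. of_real \<xi> powr (a - 1)) has_integral
          of_real x powr a / a - of_real 0 powr a / a) {0..x}"
    using assms a cont
    by (intro fundamental_theorem_of_calculus_interior has_vector_derivative_powr) auto
  thus ?thesis by simp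
qed

lemma Dz_neg_1_integral:
  assumes "Re a > 0" "z > 0"
  shows "((\<lambda>\<xi>. power_eval (Power c a b) \<xi> t) has_integral
           power_eval (Dz_neg 1 (Power c a b)) z t) {0..z}"
  using has_integral_mult_right[OF has_integral_powr_from_0[OF assms],
          of "c * of_real t powr (b - 1)"]
  by (simp add: algebra_simps)

lemma Dt_neg_1_integral:
  assumes "Re b > 0" "t > 0"
  shows "((\<lambda>\<xi>. power_eval (Power c a b) z \<xi>) has_integral
           power_eval (Dt_neg 1 1 (Power c a b)) z t) {0..t}"
proof -
  have "b \<notin> \<int>\<^sub>\<le>\<^sub>0" using assms by (auto elim!: nonpos_Ints_cases)
  hence "Gamma (b + 1) = b * Gamma b" "Gamma b \<noteq> 0"
    by (simp_all add: Gamma_plus1 Gamma_eq_zero_iff)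
  thus ?thesis
    using has_integral_mult_right[OF has_integral_powr_from_0[OF assms],
            of "c * of_real z powr (a - 1)"]
    by (simp add: mult.assoc mult.left_commute mult.commute)
qed

lemma Dz_neg_1_derivative:
  assumes "a \<noteq> 0" "z > 0"
  shows "((\<lambda>\<xi>. power_eval (Dz_neg 1 (Power c a b)) \<xi> t) has_vector_derivative
           power_eval (Power c a b) z t) (at z)"
  using has_vector_derivative_mult_right[OF has_vector_derivative_powr[OF assms(2,1)],
          of "c * of_real t powr (b - 1)"]
  by (simp add: algebra_simps)


section \<open>Formal series of operators\<close>

text \<open>
  A formal series in the two commuting operators \<open>X\<close> (\<open>D\<^sub>z\<close> to the power \<open>-1\<close>) and
  \<open>Y\<close> (\<open>D\<^sub>t\<close> to the power \<open>- \<upsilon>\<close>) is a power series in \<open>X\<close> whose coefficients are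
  power series in \<open>Y\<close>; products of operators are products of series.
\<close>

type_synonym op_series = "complex fps fps"

definition Dz_inv :: op_series where
  "Dz_inv = fps_X"

text \<open>The binomial series for \<open>1 - Y\<close> to the power \<open>- \<gamma>\<close>.\<close>

definition one_minus_Dt_neg :: "complex \<Rightarrow> op_series" where
  "one_minus_Dt_neg \<gamma> = fps_const (Abs_fps (\<lambda>l. pochhammer \<gamma> l / fact l))"

text \<open>The composition \<open>oo\<close> is meaningful for arguments without constant term in \<open>X\<close>.\<close>

definition op_3F1 :: "complex \<Rightarrow> complex \<Rightarrow> complex \<Rightarrow> complex \<Rightarrow> op_series \<Rightarrow> op_series" where
  "op_3F1 a b c d T =
     Abs_fps (\<lambda>n. fps_const
       (pochhammer a n * pochhammer b n * pochhammer c n / (pochhammer d n * fact n))) oo T"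

lemma one_minus_Dt_neg_1: "one_minus_Dt_neg 1 = fps_const (inverse (1 - fps_X))"
  by (simp add: one_minus_Dt_neg_def fps_inverse_gp'[symmetric] pochhammer_fact[symmetric])

definition op_term ::
  "complex \<Rightarrow> op_series \<Rightarrow> power_term \<Rightarrow> real \<Rightarrow> real \<Rightarrow> nat \<times> nat \<Rightarrow> complex" where
  "op_term \<upsilon> A p z t = (\<lambda>(n, l).
     fps_nth (fps_nth A n) l * power_eval (Dt_neg \<upsilon> l (Dz_neg n p)) z t)"

definition op_apply ::
  "complex \<Rightarrow> op_series \<Rightarrow> power_term \<Rightarrow> real \<Rightarrow> real \<Rightarrow> complex" where
  "op_apply \<upsilon> A p z t = infsum (op_term \<upsilon> A p z t) UNIV"

end

theory Submission imports Defs begin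

text \<open>
  Both sides are the same double series. In the operator series on the right, the factor
  \<open>(1 - Y)\<close> to the power \<open>- \<gamma>2\<close> merges with the \<open>n\<close>-th power of \<open>1 / (1 - Y)\<close> to the
  binomial series with exponent \<open>- (\<gamma>2 + n)\<close>, whose \<open>l\<close>-th coefficient completes
  \<open>(\<gamma>2)\<^sub>n\<close> to \<open>(\<gamma>2)\<^sub>l\<^sub>+\<^sub>n\<close>. The factor \<open>4\<^sup>n\<close> turns the two upper parameters \<open>\<gamma>1 / 2\<close> and
  \<open>(\<gamma>1 + 1) / 2\<close> into \<open>(\<gamma>1)\<^sub>2\<^sub>n\<close> by the duplication formula. Applying \<open>X\<^sup>n Y\<^sup>l\<close> to the power
  function produces \<open>1 / (\<theta>)\<^sub>n\<close> and the reciprocal Gamma value, and so the terms agree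
  one by one up to the prefactor (\<open>op_term_eq_ikml_term\<close>).

  What remains is analytic: the double series converges absolutely, so that the iterated sum
  is the unordered sum. Quotients of Pochhammer symbols grow more slowly than any geometric
  sequence with ratio above 1 (\<open>pochhammer_ratio_bound\<close>). Up to such factors, the modulus
  of the term of index \<open>(l, n)\<close> is that of \<open>(4 z)\<^sup>n\<close> times a binomial coefficient \<open>l + n\<close> over \<open>n\<close> times \<open>t\<^sup>\<upsilon>\<^sup>l / \<Gamma>(q + \<upsilon> l)\<close>. The
  binomial coefficient is at most \<open>s\<^sup>-\<^sup>n (1 - s)\<^sup>-\<^sup>l\<close> for every \<open>s\<close> strictly between 0 and 1; if
  \<open>4 z < s\<close>, this leaves a convergent geometric factor in \<open>n\<close>. The
  possibly huge factor \<open>(1 - s)\<^sup>-\<^sup>l\<close> is absorbed by the reciprocal Gamma function, which on the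
  ray \<open>q + \<upsilon> l\<close> decays faster than every geometric sequence (\<open>rGamma_ray_decay\<close>).
\<close>

section \<open>Decay of the reciprocal Gamma function along a ray\<close>

lemma norm_le_Re_times_exp:
  assumes "Re v > 0"
  shows "norm v \<le> Re v * exp ((Im v)\<^sup>2 / (Re v)\<^sup>2)"
proof -
  define u where "u = (Im v)\<^sup>2 / (Re v)\<^sup>2"
  have u: "u \<ge> 0" by (simp add: u_def)
  have "(norm v)\<^sup>2 = (Re v)\<^sup>2 * (1 + u)"
    using assms by (simp add: u_def cmod_power2 distrib_left)
  also have "\<dots> \<le> (Re v)\<^sup>2 * (exp u)\<^sup>2"
  proof (intro mult_left_mono)
    have "1 + u \<le> exp u" by simp
    also have "\<dots> \<le> (exp u)\<^sup>2" using u by (simp add: power2_eq_square)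
    finally show "1 + u \<le> (exp u)\<^sup>2" .
  qed simp
  also have "\<dots> = (Re v * exp u)\<^sup>2" by (simp add: power_mult_distrib)
  finally show ?thesis
    unfolding u_def by (rule power2_le_imp_le) (use assms in auto)
qed

text \<open>
  The factors \<open>w + k\<close> contribute \<open>(Im w)\<^sup>2 / (Re w + k)\<^sup>2\<close> each to the exponent; for \<open>k \<ge> 1\<close>
  this is bounded by a telescoping difference.
\<close>

lemma norm_pochhammer_le:
  assumes "Re w > 0"
  shows "norm (pochhammer w (Suc n)) \<le> pochhammer (Re w) (Suc n) *
           exp ((Im w)\<^sup>2 * (1 / (Re w)\<^sup>2 + 1 / Re w - 1 / (Re w + n)))"
proof (induction n)
  case 0
  show ?case using norm_le_Re_times_exp[OF assms] by simp
next
  case (Suc n)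
  define x where "x = Re w + n"
  have x: "x > 0" using assms by (simp add: x_def)
  let ?v = "w + of_nat (Suc n)"
  have v: "Re ?v = x + 1" "Im ?v = Im w" by (simp_all add: x_def)
  have "1 / (x + 1)\<^sup>2 \<le> 1 / (x * (x + 1))"
    using x by (intro divide_left_mono) (auto simp: power2_eq_square)
  also have "\<dots> = 1 / x - 1 / (x + 1)"
    using x by (simp add: field_simps)
  finally have "(Im w)\<^sup>2 * (1 / (x + 1)\<^sup>2) \<le> (Im w)\<^sup>2 * (1 / x - 1 / (x + 1))"
    by (rule mult_left_mono) simp
  hence "exp ((Im w)\<^sup>2 / (x + 1)\<^sup>2) \<le> exp ((Im w)\<^sup>2 * (1 / x - 1 / (x + 1)))"
    by simp
  hence "(x + 1) * exp ((Im w)\<^sup>2 / (x + 1)\<^sup>2) \<le> (x + 1) * exp ((Im w)\<^sup>2 * (1 / x - 1 / (x + 1)))"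
    using x by (intro mult_left_mono) auto
  hence "norm ?v \<le> (x + 1) * exp ((Im w)\<^sup>2 * (1 / x - 1 / (x + 1)))"
    using norm_le_Re_times_exp[of ?v] x unfolding v by linarith
  hence "norm (pochhammer w (Suc n)) * norm ?v \<le>
      (pochhammer (Re w) (Suc n) * exp ((Im w)\<^sup>2 * (1 / (Re w)\<^sup>2 + 1 / Re w - 1 / x))) *
      ((x + 1) * exp ((Im w)\<^sup>2 * (1 / x - 1 / (x + 1))))"
    by (intro mult_mono mult_nonneg_nonneg Suc.IH[folded x_def] exp_ge_zero norm_ge_zero
          less_imp_le[OF pochhammer_pos[OF assms]])
  also have "\<dots> = pochhammer (Re w) (Suc n) * (x + 1) *
      exp ((Im w)\<^sup>2 * (1 / (Re w)\<^sup>2 + 1 / Re w - 1 / x) + (Im w)\<^sup>2 * (1 / x - 1 / (x + 1)))"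
    by (simp only: exp_add mult_ac)
  also have "(Im w)\<^sup>2 * (1 / (Re w)\<^sup>2 + 1 / Re w - 1 / x) + (Im w)\<^sup>2 * (1 / x - 1 / (x + 1)) =
      (Im w)\<^sup>2 * (1 / (Re w)\<^sup>2 + 1 / Re w - 1 / (x + 1))"
    by (simp add: ring_distribs)
  finally show ?case
    unfolding pochhammer_Suc[of _ "Suc n"] norm_mult x_def
    by (simp only: of_nat_Suc add_ac)
qed

text \<open>
  Off the real axis the reciprocal Gamma function can be larger than on it, but by a factor
  of at most \<open>exp (K\<^sup>2 (1 + Re w))\<close> on the cone \<open>\<bar>Im w\<bar> \<le> K Re w\<close>.
\<close>

lemma norm_rGamma_le:
  assumes "Re w > 0"
  shows "norm (rGamma w) \<le> rGamma (Re w) * exp ((Im w)\<^sup>2 * (1 / (Re w)\<^sup>2 + 1 / Re w))"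
proof (rule LIMSEQ_le)
  show "(\<lambda>n. norm (rGamma_series w n)) \<longlonglongrightarrow> norm (rGamma w)"
    by (intro tendsto_intros)
  show "(\<lambda>n. rGamma_series (Re w) n * exp ((Im w)\<^sup>2 * (1 / (Re w)\<^sup>2 + 1 / Re w)))
          \<longlonglongrightarrow> rGamma (Re w) * exp ((Im w)\<^sup>2 * (1 / (Re w)\<^sup>2 + 1 / Re w))"
    by (intro tendsto_intros)
  have "norm (rGamma_series w n) \<le>
      rGamma_series (Re w) n * exp ((Im w)\<^sup>2 * (1 / (Re w)\<^sup>2 + 1 / Re w))" for n
  proof -
    define E where "E = exp ((Im w)\<^sup>2 * (1 / (Re w)\<^sup>2 + 1 / Re w))"
    have "(Im w)\<^sup>2 * (1 / (Re w)\<^sup>2 + 1 / Re w - 1 / (Re w + n)) \<le>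
        (Im w)\<^sup>2 * (1 / (Re w)\<^sup>2 + 1 / Re w)"
      using assms by (intro mult_left_mono) auto
    hence "norm (pochhammer w (Suc n)) \<le> pochhammer (Re w) (Suc n) * E"
      unfolding E_def
      by (intro order.trans[OF norm_pochhammer_le[OF assms]] mult_left_mono)
         (auto intro: less_imp_le[OF pochhammer_pos[OF assms]])
    hence "norm (pochhammer w (Suc n)) / (fact n * exp (Re w * ln n)) \<le>
        pochhammer (Re w) (Suc n) * E / (fact n * exp (Re w * ln n))"
      by (intro divide_right_mono) auto
    thus ?thesis
      by (simp add: rGamma_series_def E_def norm_divide norm_mult del: pochhammer_Suc)
  qed
  thus "\<exists>N. \<forall>n\<ge>N. norm (rGamma_series w n) \<le>
      rGamma_series (Re w) n * exp ((Im w)\<^sup>2 * (1 / (Re w)\<^sup>2 + 1 / Re w))"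
    by blast
qed

text \<open>
  The part of Euler's integral between \<open>M\<close> and \<open>M + 1\<close> suffices to see that the Gamma
  function outgrows every exponential function.
\<close>

lemma Gamma_real_ge_powr:
  fixes x M :: real
  assumes "x > 0" "M > 0"
  shows "M powr x / ((M + 1) * exp (M + 1)) \<le> Gamma x"
proof -
  define c where "c = M powr x / ((M + 1) * exp (M + 1))"
  have "((\<lambda>s. c) has_integral c) {M..M+1}"
    using has_integral_const_real[of c M "M + 1"] by simp
  hence "((\<lambda>s. if s \<in> {M..M+1} then c else 0) has_integral c) {0..}"
    using assms by (subst has_integral_restrict) auto
  moreover have "((\<lambda>s. s powr (x - 1) / exp s) has_integral Gamma x) {0..}"
    by (rule Gamma_integral_real[OF assms(1)])
  moreover have "(if s \<in> {M..M+1} then c else 0) \<le> s powr (x - 1) / exp s" for s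
  proof (cases "s \<in> {M..M+1}")
    case True
    have "c \<le> s powr x / (s * exp s)"
      unfolding c_def using True assms
      by (intro frac_le powr_mono2 mult_mono mult_pos_pos) auto
    also have "\<dots> = s powr (x - 1) / exp s"
      using True assms by (simp add: powr_diff)
    finally show ?thesis using True by simp
  qed auto
  ultimately show ?thesis unfolding c_def[symmetric]
    by (rule has_integral_le)
qed

text \<open>
  The ray lies in a cone around the positive real axis, on which the previous bounds give
  \<open>\<bar>1 / \<Gamma>(w)\<bar> \<le> const \<cdot> (exp (K\<^sup>2) / M) powr Re w\<close> with \<open>M\<close> still free. As \<open>Re w\<close> grows by
  \<open>Re \<upsilon>\<close> in each step, a large \<open>M\<close> makes the decay as fast as desired.
\<close>

lemma rGamma_ray_decay:
  fixes q \<upsilon> :: complex and \<rho> :: real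
  assumes "Re q > 0" "Re \<upsilon> > 0" "\<rho> > 0"
  shows "\<exists>C\<ge>0. \<forall>l. norm (rGamma (q + \<upsilon> * of_nat l)) \<le> C * \<rho> ^ l"
proof -
  define K where "K = \<bar>Im q\<bar> / Re q + \<bar>Im \<upsilon>\<bar> / Re \<upsilon>"
  \<comment> \<open>The exponent that makes \<open>exp (K\<^sup>2 x) / M\<^sup>x\<close> equal to \<open>\<rho>\<close> to the power \<open>x / Re \<upsilon>\<close>.\<close>
  define m where "m = K\<^sup>2 - ln \<rho> / Re \<upsilon>"
  define M where "M = exp m"
  define C where "C = (M + 1) * exp (M + 1) * exp (K\<^sup>2) * exp (ln \<rho> * Re q / Re \<upsilon>)"
  have M: "M > 0" by (simp add: M_def)
  have "norm (rGamma (q + \<upsilon> * of_nat l)) \<le> C * \<rho> ^ l" for l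
  proof -
    define w where "w = q + \<upsilon> * of_nat l"
    define x where "x = Re w"
    have x: "x = Re q + Re \<upsilon> * l" by (simp add: x_def w_def)
    have x0: "x > 0" using assms by (simp add: x add_pos_nonneg)
    have "\<bar>Im w\<bar> \<le> \<bar>Im q\<bar> + \<bar>Im \<upsilon>\<bar> * l"
      unfolding w_def by (simp add: abs_mult order.trans[OF abs_triangle_ineq])
    also have "\<dots> \<le> K * Re q + K * Re \<upsilon> * l"
      using assms by (intro add_mono mult_right_mono) (auto simp: K_def field_simps)
    also have "\<dots> = K * x" by (simp add: x algebra_simps)
    finally have "(Im w)\<^sup>2 \<le> (K * x)\<^sup>2" by (metis abs_ge_zero power2_abs power_mono)
    hence "(Im w)\<^sup>2 * (1 / x\<^sup>2 + 1 / x) \<le> (K * x)\<^sup>2 * (1 / x\<^sup>2 + 1 / x)"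
      using x0 by (intro mult_right_mono) auto
    also have "\<dots> = K\<^sup>2 + K\<^sup>2 * x"
      using x0 by (simp add: field_simps power2_eq_square)
    finally have expo: "(Im w)\<^sup>2 * (1 / x\<^sup>2 + 1 / x) \<le> K\<^sup>2 + K\<^sup>2 * x" .
    have Mx: "M powr x = exp (m * x)" by (simp add: M_def powr_def)
    have "rGamma x = inverse (Gamma x)" by (simp add: rGamma_inverse_Gamma)
    also have "\<dots> \<le> inverse (M powr x / ((M + 1) * exp (M + 1)))"
      using M x0 by (intro le_imp_inverse_le Gamma_real_ge_powr) auto
    also have "\<dots> = (M + 1) * exp (M + 1) * exp (- (m * x))"
      by (simp add: Mx exp_minus field_simps)
    finally have rG: "rGamma x \<le> (M + 1) * exp (M + 1) * exp (- (m * x))" .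
    have "norm (rGamma w) \<le> rGamma x * exp ((Im w)\<^sup>2 * (1 / x\<^sup>2 + 1 / x))"
      using norm_rGamma_le[of w] x0 by (simp add: x_def)
    also have "\<dots> \<le> ((M + 1) * exp (M + 1) * exp (- (m * x))) * exp (K\<^sup>2 + K\<^sup>2 * x)"
      using rG expo M by (intro mult_mono) auto
    also have "\<dots> = (M + 1) * exp (M + 1) * exp (K\<^sup>2) * exp (K\<^sup>2 * x - m * x)"
      by (simp add: exp_add exp_diff exp_minus field_simps)
    also have "K\<^sup>2 * x - m * x = ln \<rho> * Re q / Re \<upsilon> + l * ln \<rho>"
      using assms by (simp add: m_def x field_simps)
    also have "exp \<dots> = exp (ln \<rho> * Re q / Re \<upsilon>) * \<rho> ^ l"
      using assms by (simp add: exp_add exp_of_nat_mult)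
    finally show ?thesis by (simp add: w_def C_def mult.assoc)
  qed
  moreover have "C \<ge> 0" using M by (simp add: C_def)
  ultimately show ?thesis by blast
qed

section \<open>Absolute convergence of the double series\<close>

text \<open>
  The quotient of consecutive terms of \<open>(a)\<^sub>n / (b)\<^sub>n\<close> tends to 1, so it is below \<open>r\<close> from some
  index on.
\<close>

lemma pochhammer_ratio_bound:
  fixes a b :: "'a :: {real_normed_field, banach}" and r :: real
  assumes b: "b \<notin> \<int>\<^sub>\<le>\<^sub>0" and r: "r > 1"
  shows "\<exists>C\<ge>0. \<forall>n. norm (pochhammer a n / pochhammer b n) \<le> C * r ^ n"
proof -
  define u where "u n = norm (pochhammer a n / pochhammer b n) / r ^ n" for n
  define N where "N = nat \<lceil>norm b + norm (a - b) / (r - 1)\<rceil>"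
  have u0: "u n \<ge> 0" for n using r by (simp add: u_def)
  have nz: "b + of_nat n \<noteq> 0" for n
    using b by (metis add_eq_0_iff2 minus_of_nat_in_nonpos_Ints)
  have step: "u (Suc n) \<le> u n" if "n \<ge> N" for n
  proof -
    have "norm b + norm (a - b) / (r - 1) \<le> real n"
      using that unfolding N_def by linarith
    also have "real n \<le> norm (b + of_nat n) + norm b"
      using norm_triangle_ineq4[of "b + of_nat n" b] by simp
    finally have "norm (a - b) \<le> (r - 1) * norm (b + of_nat n)"
      using r by (simp add: field_simps)
    moreover have "norm (a + of_nat n) \<le> norm (b + of_nat n) + norm (a - b)"
      using norm_triangle_ineq[of "b + of_nat n" "a - b"] by (simp add: add.commute)
    ultimately have "norm (a + of_nat n) \<le> r * norm (b + of_nat n)"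
      by (simp add: algebra_simps)
    hence "norm (a + of_nat n) / (r * norm (b + of_nat n)) \<le> 1"
      using r nz[of n] by (simp add: field_simps)
    moreover have "u (Suc n) = u n * (norm (a + of_nat n) / (r * norm (b + of_nat n)))"
      by (simp add: u_def pochhammer_Suc norm_divide norm_mult)
    ultimately show ?thesis
      using mult_left_mono[OF _ u0[of n]] by fastforce
  qed
  have uN: "u n \<le> u N" if "n \<ge> N" for n
    using that by (induction n rule: dec_induct) (auto intro: order.trans[OF step])
  have "u n \<le> (\<Sum>k\<le>N. u k)" for n
  proof (cases "n \<le> N")
    case True
    thus ?thesis by (intro member_le_sum) (auto simp: u0)
  next
    case False
    hence "u n \<le> u N" using uN by simp
    also have "\<dots> \<le> (\<Sum>k\<le>N. u k)" by (intro member_le_sum) (auto simp: u0)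
    finally show ?thesis .
  qed
  hence "norm (pochhammer a n / pochhammer b n) \<le> (\<Sum>k\<le>N. u k) * r ^ n" for n
    using r by (simp add: u_def divide_le_eq)
  moreover have "(\<Sum>k\<le>N. u k) \<ge> 0" by (intro sum_nonneg u0)
  ultimately show ?thesis by blast
qed

text \<open>The left-hand side is one summand of the binomial expansion of \<open>(s + (1 - s))\<^sup>l\<^sup>+\<^sup>n\<close>.\<close>

lemma binomial_times_powers_le_1:
  fixes s :: real
  assumes "0 \<le> s" "s \<le> 1"
  shows "of_nat ((l + n) choose n) * s ^ n * (1 - s) ^ l \<le> 1"
proof -
  let ?f = "\<lambda>k. of_nat ((l + n) choose k) * s ^ k * (1 - s) ^ (l + n - k)"
  have "?f n \<le> (\<Sum>k\<le>l + n. ?f k)"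
    using assms by (intro member_le_sum) auto
  also have "\<dots> = (s + (1 - s)) ^ (l + n)" by (rule binomial_ring[symmetric])
  finally show ?thesis by simp
qed

lemma pochhammer_double_halves:
  fixes a :: "'a :: field_char_0"
  shows "pochhammer a (2 * n) = 4 ^ n * pochhammer (a / 2) n * pochhammer ((a + 1) / 2) n"
  using pochhammer_double[of "a / 2" n] by (simp add: power_mult add_divide_distrib)

text \<open>
  The ratio \<open>1 / 2\<close> is an arbitrary choice below 1: whatever grows geometrically in \<open>l\<close> is
  collected in one constant \<open>R\<close>, and the reciprocal Gamma function provides \<open>(1 / (2 R))\<^sup>l\<close>.
\<close>

lemma ikml_term_bound:
  fixes q \<upsilon> \<gamma>1 \<gamma>2 \<gamma>3 \<gamma>4 :: complex and z t :: real
  assumes q: "Re q > 0" and \<upsilon>: "Re \<upsilon> > 0"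
    and \<gamma>3: "\<gamma>3 \<notin> \<int>\<^sub>\<le>\<^sub>0" and \<gamma>4: "\<gamma>4 \<notin> \<int>\<^sub>\<le>\<^sub>0"
    and z: "\<bar>z\<bar> < 1 / 4" and t: "0 < t"
  obtains x C where "0 \<le> x" "x < 1"
    "\<And>l n. norm (ikml_term \<gamma>1 \<gamma>2 \<gamma>3 \<gamma>4 q \<upsilon> z t l n) \<le> C * x ^ n * (1 / 2) ^ l"
proof -
  \<comment> \<open>The ratio \<open>r\<close> serves three times for quotients of Pochhammer symbols, once as
      \<open>1 / s\<close> for the binomial coefficient, and once more to leave the factor \<open>1 / r\<close>.\<close>
  obtain r :: real where r: "r > 1" and zr: "4 * \<bar>z\<bar> * r ^ 5 \<le> 1"
  proof -
    define y where "y = max (4 * \<bar>z\<bar>) (1 / 2)"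
    have y: "0 < y" "y < 1" "4 * \<bar>z\<bar> \<le> y" using z by (auto simp: y_def)
    show ?thesis
    proof (rule that[of "root 5 (1 / y)"])
      show "root 5 (1 / y) > 1" using y by simp
      show "4 * \<bar>z\<bar> * root 5 (1 / y) ^ 5 \<le> 1" using y by simp
    qed
  qed
  define \<tau> where "\<tau> = t powr Re \<upsilon>"
  define R where "R = \<tau> * r / (1 - 1 / r)"
  have \<tau>: "\<tau> > 0" using t by (simp add: \<tau>_def)
  have R: "R > 0" using r \<tau> by (simp add: R_def)
  obtain C1 where C1: "C1 \<ge> 0" "\<And>n. norm (pochhammer (\<gamma>1 / 2) n / pochhammer \<gamma>3 n) \<le> C1 * r ^ n"
    using pochhammer_ratio_bound[OF \<gamma>3 r] by blast
  obtain C2 where C2: "C2 \<ge> 0" "\<And>n. norm (pochhammer ((\<gamma>1 + 1) / 2) n / pochhammer \<gamma>4 n) \<le> C2 * r ^ n"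
    using pochhammer_ratio_bound[OF \<gamma>4 r] by blast
  have one: "(1 :: complex) \<notin> \<int>\<^sub>\<le>\<^sub>0" by simp
  obtain C3 where C3: "C3 \<ge> 0" "\<And>n. norm (pochhammer \<gamma>2 n / pochhammer 1 n) \<le> C3 * r ^ n"
    using pochhammer_ratio_bound[OF one r] by blast
  obtain C4 where C4: "C4 \<ge> 0"
    "\<And>l. norm (rGamma (q + \<upsilon> * of_nat l)) \<le> C4 * (1 / (2 * R)) ^ l"
    using rGamma_ray_decay[OF q \<upsilon>, of "1 / (2 * R)"] R by auto
  define C where "C = C1 * C2 * C3 * C4"
  have bound: "norm (ikml_term \<gamma>1 \<gamma>2 \<gamma>3 \<gamma>4 q \<upsilon> z t l n) \<le> C * (1 / r) ^ n * (1 / 2) ^ l" for l n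
  proof -
    define B where "B = real ((l + n) choose n)"
    define P1 where "P1 = pochhammer (\<gamma>1 / 2) n / pochhammer \<gamma>3 n"
    define P2 where "P2 = pochhammer ((\<gamma>1 + 1) / 2) n / pochhammer \<gamma>4 n"
    define P3 where "P3 = pochhammer \<gamma>2 (l + n) / pochhammer 1 (l + n)"
    define P4 where "P4 = rGamma (q + \<upsilon> * of_nat l)"
    define T where "T = complex_of_real t powr (\<upsilon> * of_nat l)"
    have "complex_of_real B = fact (l + n) / (fact n * fact l)"
      unfolding B_def by (simp add: binomial_fact)
    hence "P3 * of_real B = pochhammer \<gamma>2 (l + n) / (fact n * fact l)"
      by (simp add: P3_def pochhammer_fact[symmetric])
    moreover have "P4 = 1 / Gamma (q + \<upsilon> * of_nat l)"
      by (simp add: P4_def rGamma_inverse_Gamma inverse_eq_divide)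
    moreover have "complex_of_real (- 4 * z) ^ n = (-1) ^ n * 4 ^ n * of_real z ^ n"
      by (simp add: power_mult_distrib[symmetric])
    ultimately have "ikml_term \<gamma>1 \<gamma>2 \<gamma>3 \<gamma>4 q \<upsilon> z t l n =
        P1 * P2 * (P3 * of_real B) * P4 * T * (of_real (- 4 * z)) ^ n"
      unfolding ikml_term_def pochhammer_double_halves P1_def P2_def T_def
      by (simp only:) (simp add: mult_ac)
    hence eq: "norm (ikml_term \<gamma>1 \<gamma>2 \<gamma>3 \<gamma>4 q \<upsilon> z t l n) =
        norm P1 * norm P2 * norm P3 * B * norm P4 * norm T * (4 * \<bar>z\<bar>) ^ n"
      by (simp add: norm_mult norm_power B_def)
    have T: "norm T = \<tau> ^ l"
      using t by (simp add: T_def \<tau>_def norm_powr_real_powr powr_powr[symmetric] powr_realpow)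
    have "B * (1 / r) ^ n * (1 - 1 / r) ^ l \<le> 1"
      unfolding B_def using r by (intro binomial_times_powers_le_1) auto
    hence B: "B \<le> r ^ n / (1 - 1 / r) ^ l"
      using r by (simp add: pos_le_divide_eq power_divide mult.commute)
    have z4: "(4 * \<bar>z\<bar>) ^ n \<le> (1 / r ^ 5) ^ n"
      using zr r by (intro power_mono) (auto simp: field_simps)
    have "norm P1 * norm P2 * norm P3 * B * norm P4 * norm T * (4 * \<bar>z\<bar>) ^ n \<le>
        (C1 * r ^ n) * (C2 * r ^ n) * (C3 * r ^ (l + n)) * (r ^ n / (1 - 1 / r) ^ l)
          * (C4 * (1 / (2 * R)) ^ l) * \<tau> ^ l * (1 / r ^ 5) ^ n"
      unfolding T P1_def P2_def P3_def P4_def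
      by (intro mult_mono C1 C2 C3 C4 B z4 order.refl mult_nonneg_nonneg)
         (use r R \<tau> C1(1) C2(1) C3(1) C4(1) in \<open>auto simp: B_def\<close>)
    also have "\<dots> = C * ((r ^ n) ^ 4 * (1 / r ^ 5) ^ n) *
        (r ^ l / (1 - 1 / r) ^ l * \<tau> ^ l * (1 / (2 * R)) ^ l)"
      by (simp add: C_def power_add power4_eq_xxxx)
    also have "(r ^ n) ^ 4 * (1 / r ^ 5) ^ n = (r ^ 4 * (1 / r ^ 5)) ^ n"
      unfolding power_mult_distrib by (simp only: power_mult[symmetric] mult.commute)
    also have "r ^ 4 * (1 / r ^ 5) = 1 / r"
      using r by (simp add: eval_nat_numeral)
    also have "r ^ l / (1 - 1 / r) ^ l * \<tau> ^ l * (1 / (2 * R)) ^ l = (R * (1 / (2 * R))) ^ l"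
      unfolding R_def by (simp only: power_mult_distrib power_divide) (simp add: mult_ac)
    also have "R * (1 / (2 * R)) = 1 / 2" using R by simp
    finally show ?thesis unfolding eq .
  qed
  show thesis by (rule that[OF _ _ bound]) (use r in auto)
qed

lemma ikml_abs_summable:
  fixes q \<upsilon> \<gamma>1 \<gamma>2 \<gamma>3 \<gamma>4 :: complex and z t :: real
  assumes "Re q > 0" "Re \<upsilon> > 0" "\<gamma>3 \<notin> \<int>\<^sub>\<le>\<^sub>0" "\<gamma>4 \<notin> \<int>\<^sub>\<le>\<^sub>0" "\<bar>z\<bar> < 1 / 4" "0 < t"
  shows "(\<lambda>(l, n). norm (ikml_term \<gamma>1 \<gamma>2 \<gamma>3 \<gamma>4 q \<upsilon> z t l n)) summable_on UNIV"
proof -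
  obtain x C where x: "0 \<le> x" "x < 1"
    and bound: "\<And>l n. norm (ikml_term \<gamma>1 \<gamma>2 \<gamma>3 \<gamma>4 q \<upsilon> z t l n) \<le> C * x ^ n * (1 / 2) ^ l"
    by (rule ikml_term_bound[OF assms, where ?\<gamma>1.0 = \<gamma>1 and ?\<gamma>2.0 = \<gamma>2]) (rule that)
  have geo: "((\<lambda>n. c ^ n) has_sum (1 / (1 - c))) UNIV" if "0 \<le> c" "c < 1" for c :: real
    using that by (intro norm_summable_imp_has_sum) (auto intro!: geometric_sums summable_geometric)
  have "(\<lambda>(l, n). (1 / 2) ^ l * x ^ n) summable_on (UNIV :: nat set) \<times> (UNIV :: nat set)"
  proof (rule summable_on_SigmaI)
    show "((\<lambda>n. case (l, n) of (l, n) \<Rightarrow> (1 / 2) ^ l * x ^ n) has_sum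
        (1 / 2) ^ l * (1 / (1 - x))) UNIV" for l
      unfolding prod.case using x by (intro has_sum_cmult_right geo)
    show "(\<lambda>l. (1 / 2 :: real) ^ l * (1 / (1 - x))) summable_on UNIV"
      by (intro summable_on_cmult_left has_sum_imp_summable[OF geo]) auto
  qed (use x in auto)
  hence "(\<lambda>p. C * (case p of (l, n) \<Rightarrow> (1 / 2) ^ l * x ^ n)) summable_on UNIV"
    by (intro summable_on_cmult_right) simp
  thus ?thesis
    unfolding case_prod_unfold
    by (rule Infinite_Sum.abs_summable_on_comparison_test') (auto intro: order.trans[OF bound] simp: mult_ac)
qed

lemma infsum_eq_suminf_suminf:
  fixes f :: "nat \<Rightarrow> nat \<Rightarrow> 'a :: banach"
  assumes "(\<lambda>(l, n). norm (f l n)) summable_on UNIV"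
  shows "infsum (\<lambda>(l, n). f l n) UNIV = (\<Sum>l. \<Sum>n. f l n)"
proof -
  have abs: "(\<lambda>p. norm (case p of (l, n) \<Rightarrow> f l n)) summable_on Sigma UNIV (\<lambda>_. UNIV)"
    using assms by (simp add: case_prod_unfold)
  have sums: "infsum g UNIV = suminf g" if "(\<lambda>n. norm (g n)) summable_on UNIV" for g :: "nat \<Rightarrow> 'a"
  proof -
    have "summable (\<lambda>n. norm (g n))" using that by (rule summable_on_imp_summable)
    thus ?thesis
      by (intro infsumI norm_summable_imp_has_sum) (auto simp: summable_norm_cancel summable_sums)
  qed
  have inner: "infsum (f l) UNIV = suminf (f l)" for l
    using abs unfolding Infinite_Sum.abs_summable_on_Sigma_iff by (intro sums) auto
  have "(\<lambda>l. norm (infsum (f l) UNIV)) summable_on UNIV"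
  proof (rule Infinite_Sum.abs_summable_on_comparison_test)
    show "(\<lambda>l. norm (infsum (\<lambda>n. norm (f l n)) UNIV)) summable_on UNIV"
      using abs unfolding Infinite_Sum.abs_summable_on_Sigma_iff by simp
    show "norm (infsum (f l) UNIV) \<le> norm (infsum (\<lambda>n. norm (f l n)) UNIV)" for l
      using abs unfolding Infinite_Sum.abs_summable_on_Sigma_iff
      by (auto intro!: norm_infsum_bound order.trans[OF _ abs_ge_self])
  qed
  hence "infsum (\<lambda>l. infsum (f l) UNIV) UNIV = (\<Sum>l. infsum (f l) UNIV)"
    by (rule sums)
  moreover have "infsum (\<lambda>l. infsum (f l) UNIV) UNIV = infsum (\<lambda>(l, n). f l n) (UNIV \<times> UNIV)"
    using abs_summable_summable[OF abs] by (intro infsum_Sigma'_banach) simp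
  ultimately show ?thesis by (simp add: inner)
qed

section \<open>The coefficients of the operator series\<close>

text \<open>
  Multiplying by \<open>1 / (1 - Y)\<close> raises \<open>\<gamma>\<close> by 1; cleared of the denominator, this is the
  Pascal rule for the coefficients \<open>(\<gamma>)\<^sub>l / l!\<close>.
\<close>

lemma one_minus_Dt_neg_mult_1: "one_minus_Dt_neg \<gamma> * one_minus_Dt_neg 1 = one_minus_Dt_neg (\<gamma> + 1)"
proof -
  define S where "S \<gamma> = Abs_fps (\<lambda>l. pochhammer \<gamma> l / fact l)" for \<gamma> :: complex
  have "S (\<gamma> + 1) * (1 - fps_X) = S \<gamma>"
  proof (rule fps_ext)
    fix l
    show "fps_nth (S (\<gamma> + 1) * (1 - fps_X)) l = fps_nth (S \<gamma>) l"
    proof (cases l)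
      case (Suc k)
      have "pochhammer (\<gamma> + 1) (Suc k) / fact (Suc k) - pochhammer (\<gamma> + 1) k / fact k =
          pochhammer \<gamma> (Suc k) / fact (Suc k)"
        unfolding pochhammer_Suc[of "\<gamma> + 1" k] pochhammer_rec[of \<gamma> k]
        by (simp add: divide_simps del: of_nat_Suc) (simp add: algebra_simps)
      thus ?thesis by (simp add: Suc S_def ring_distribs)
    qed (simp add: S_def ring_distribs)
  qed
  moreover have "(1 - fps_X :: complex fps) * inverse (1 - fps_X) = 1"
    by (rule inverse_mult_eq_1') simp
  ultimately have "S \<gamma> * inverse (1 - fps_X) = S (\<gamma> + 1)"
    by (metis mult.assoc mult.right_neutral)
  thus ?thesis
    by (simp add: one_minus_Dt_neg_1 one_minus_Dt_neg_def[of \<gamma>] one_minus_Dt_neg_def[of "\<gamma> + 1"]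
          S_def)
qed

lemma one_minus_Dt_neg_mult_1_power:
  "one_minus_Dt_neg \<gamma> * one_minus_Dt_neg 1 ^ n = one_minus_Dt_neg (\<gamma> + of_nat n)"
proof (induction n)
  case (Suc n)
  have "one_minus_Dt_neg \<gamma> * one_minus_Dt_neg 1 ^ Suc n =
      (one_minus_Dt_neg \<gamma> * one_minus_Dt_neg 1 ^ n) * one_minus_Dt_neg 1"
    by (simp only: power_Suc mult_ac)
  thus ?case by (simp add: Suc one_minus_Dt_neg_mult_1 add_ac)
qed simp

text \<open>
  The argument of the hypergeometric series is a multiple of \<open>X\<close>, so the coefficient of \<open>X\<^sup>n\<close>
  comes from its \<open>n\<close>-th term alone, and the remaining factors in \<open>Y\<close> combine by the exponent law.
\<close>

lemma op_series_nth:
  "fps_nth (fps_nth (one_minus_Dt_neg \<gamma>2 *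
      op_3F1 (\<gamma>1 / 2) ((\<gamma>1 + 1) / 2) \<gamma>2 \<gamma>3 (- 4 * Dz_inv * one_minus_Dt_neg 1)) n) l =
    (-1) ^ n * pochhammer \<gamma>1 (2 * n) * pochhammer \<gamma>2 (l + n) / (pochhammer \<gamma>3 n * fact n * fact l)"
proof -
  define S where "S \<gamma> = Abs_fps (\<lambda>l. pochhammer \<gamma> l / fact l)" for \<gamma> :: complex
  define c where "c n = pochhammer (\<gamma>1 / 2) n * pochhammer ((\<gamma>1 + 1) / 2) n * pochhammer \<gamma>2 n
      / (pochhammer \<gamma>3 n * fact n)" for n
  have S: "one_minus_Dt_neg \<gamma> = fps_const (S \<gamma>)" for \<gamma>
    by (simp add: one_minus_Dt_neg_def S_def)
  have SS: "S \<gamma>2 * S 1 ^ n = S (\<gamma>2 + of_nat n)"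
    using one_minus_Dt_neg_mult_1_power[of \<gamma>2 n]
    by (simp add: S fps_const_power fps_const_mult del: fps_const_mult_apply_left)
  have "- 4 * Dz_inv * one_minus_Dt_neg 1 = fps_const (fps_const (- 4) * S 1) * fps_X"
    by (simp add: S Dz_inv_def numeral_fps_const mult_ac fps_const_neg[symmetric] del: fps_const_neg)
  hence "op_3F1 (\<gamma>1 / 2) ((\<gamma>1 + 1) / 2) \<gamma>2 \<gamma>3 (- 4 * Dz_inv * one_minus_Dt_neg 1) =
      Abs_fps (\<lambda>n. (fps_const (- 4) * S 1) ^ n * fps_const (c n))"
    by (simp add: op_3F1_def fps_compose_linear c_def)
  hence "fps_nth (one_minus_Dt_neg \<gamma>2 *
      op_3F1 (\<gamma>1 / 2) ((\<gamma>1 + 1) / 2) \<gamma>2 \<gamma>3 (- 4 * Dz_inv * one_minus_Dt_neg 1)) n =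
      S \<gamma>2 * ((fps_const (- 4) * S 1) ^ n * fps_const (c n))"
    by (simp add: S)
  also have "\<dots> = fps_const ((- 4) ^ n * c n) * (S \<gamma>2 * S 1 ^ n)"
    by (simp add: power_mult_distrib fps_const_mult[symmetric] mult_ac
          del: fps_const_mult)
  also have "fps_nth \<dots> l = (- 4) ^ n * c n * (pochhammer (\<gamma>2 + of_nat n) l / fact l)"
    unfolding SS by (simp add: S_def)
  also have "\<dots> = (-1) ^ n * (4 ^ n * pochhammer (\<gamma>1 / 2) n * pochhammer ((\<gamma>1 + 1) / 2) n) *
      (pochhammer \<gamma>2 n * pochhammer (\<gamma>2 + of_nat n) l) / (pochhammer \<gamma>3 n * fact n * fact l)"
    by (simp add: c_def power_minus[of 4])
  also have "pochhammer \<gamma>2 n * pochhammer (\<gamma>2 + of_nat n) l = pochhammer \<gamma>2 (l + n)"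
    using pochhammer_product'[of \<gamma>2 n l] by (simp only: add.commute[of n l])
  finally show ?thesis by (simp only: pochhammer_double_halves)
qed

section \<open>Comparison of the two double series\<close>

lemma op_term_eq_ikml_term:
  fixes q \<upsilon> \<gamma>1 \<gamma>2 \<gamma>3 \<theta> :: complex and z t :: real
  assumes q: "q \<notin> \<int>\<^sub>\<le>\<^sub>0" and z: "0 < z"
  shows "op_term \<upsilon> (one_minus_Dt_neg \<gamma>2 *
        op_3F1 (\<gamma>1 / 2) ((\<gamma>1 + 1) / 2) \<gamma>2 \<gamma>3 (- 4 * Dz_inv * one_minus_Dt_neg 1))
      (Power (1 / Gamma q) \<theta> q) z t (n, l) =
    of_real z powr (\<theta> - 1) * of_real t powr (q - 1) * ikml_term \<gamma>1 \<gamma>2 \<gamma>3 \<theta> q \<upsilon> z t l n"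
proof -
  have "Gamma q \<noteq> 0" using q by (simp add: Gamma_eq_zero_iff)
  moreover have "\<theta> + of_nat n - 1 = (\<theta> - 1) + of_nat n" by simp
  hence "complex_of_real z powr (\<theta> + of_nat n - 1) = of_real z powr (\<theta> - 1) * of_real z ^ n"
    using z by (simp only: powr_add) (simp add: powr_nat')
  moreover have "q + \<upsilon> * of_nat l - 1 = (q - 1) + \<upsilon> * of_nat l" by simp
  hence "complex_of_real t powr (q + \<upsilon> * of_nat l - 1) =
      of_real t powr (q - 1) * of_real t powr (\<upsilon> * of_nat l)"
    by (simp only: powr_add)
  ultimately show ?thesis
    unfolding op_term_def ikml_term_def prod.case op_series_nth by (simp add: mult_ac)
qed

theorem theorem13:
  fixes q \<upsilon> \<gamma>1 \<gamma>2 \<gamma>3 \<theta> :: complex and z t :: real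
    and A :: op_series and f :: power_term
  assumes "Re q > 0" and "Re \<upsilon> > 0"
    and "\<gamma>3 \<notin> \<int>\<^sub>\<le>\<^sub>0" and "\<theta> \<notin> \<int>\<^sub>\<le>\<^sub>0"
    and "0 < z" and "z < 1 / 4" and "0 < t"
    and "A = one_minus_Dt_neg \<gamma>2 *
      op_3F1 (\<gamma>1 / 2) ((\<gamma>1 + 1) / 2) \<gamma>2 \<gamma>3 (- 4 * Dz_inv * one_minus_Dt_neg 1)"
    and "f = Power (1 / Gamma q) \<theta> q"
  shows "(\<lambda>(l, n). ikml_term \<gamma>1 \<gamma>2 \<gamma>3 \<theta> q \<upsilon> z t l n) summable_on UNIV
    \<and> op_term \<upsilon> A f z t summable_on UNIV
    \<and> ikml \<gamma>1 \<gamma>2 \<gamma>3 \<theta> q \<upsilon> z t =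
        of_real z powr (1 - \<theta>) * of_real t powr (1 - q) * op_apply \<upsilon> A f z t"
proof -
  define F where "F = (\<lambda>(l, n). ikml_term \<gamma>1 \<gamma>2 \<gamma>3 \<theta> q \<upsilon> z t l n)"
  define k where "k = complex_of_real z powr (\<theta> - 1) * of_real t powr (q - 1)"
  have abs: "(\<lambda>(l, n). norm (ikml_term \<gamma>1 \<gamma>2 \<gamma>3 \<theta> q \<upsilon> z t l n)) summable_on UNIV"
    using assms by (intro ikml_abs_summable) auto
  hence "(\<lambda>p. norm (F p)) summable_on UNIV" by (simp add: F_def case_prod_unfold)
  hence F: "F summable_on UNIV" by (rule abs_summable_summable)
  have q: "q \<notin> \<int>\<^sub>\<le>\<^sub>0" using assms(1) by (auto elim!: nonpos_Ints_cases)
  have op: "op_term \<upsilon> A f z t = (\<lambda>p. k * (F \<circ> prod.swap) p)"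
    using op_term_eq_ikml_term[OF q assms(5)]
    by (auto simp: fun_eq_iff assms(8,9) F_def k_def)
  have swap: "inj (prod.swap :: nat \<times> nat \<Rightarrow> _)" "range (prod.swap :: nat \<times> nat \<Rightarrow> _) = UNIV"
    by auto
  have Fs: "(F \<circ> prod.swap) summable_on UNIV"
    using F summable_on_reindex[OF swap(1), of F] by (simp add: swap)
  have "infsum (F \<circ> prod.swap) UNIV = infsum F UNIV"
    using infsum_reindex[OF swap(1), of F] by (simp add: swap)
  hence "op_apply \<upsilon> A f z t = k * infsum F UNIV"
    unfolding op_apply_def op by (simp add: infsum_cmult_right' o_def)
  also have "infsum F UNIV = ikml \<gamma>1 \<gamma>2 \<gamma>3 \<theta> q \<upsilon> z t"
    unfolding F_def ikml_def using abs by (rule infsum_eq_suminf_suminf)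
  finally have app: "op_apply \<upsilon> A f z t = k * ikml \<gamma>1 \<gamma>2 \<gamma>3 \<theta> q \<upsilon> z t" .
  have inv: "complex_of_real x powr (1 - a) * of_real x powr (a - 1) = 1" if "x > 0" for x a
    using that by (simp add: powr_add[symmetric])
  have "complex_of_real z powr (1 - \<theta>) * of_real t powr (1 - q) * k =
      (of_real z powr (1 - \<theta>) * of_real z powr (\<theta> - 1)) *
      (of_real t powr (1 - q) * of_real t powr (q - 1))"
    by (simp add: k_def mult_ac)
  also have "\<dots> = 1" using assms by (simp add: inv)
  finally have "ikml \<gamma>1 \<gamma>2 \<gamma>3 \<theta> q \<upsilon> z t =
      of_real z powr (1 - \<theta>) * of_real t powr (1 - q) * op_apply \<upsilon> A f z t"
    by (metis app mult.assoc mult.left_neutral)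
  moreover have "op_term \<upsilon> A f z t summable_on UNIV"
    unfolding op by (intro summable_on_cmult_right Fs)
  ultimately show ?thesis using F unfolding F_def by blast
qed

end
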